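(* Let $G$ be a graph. Then: (i) $L_0(G) \ge \chi(G) \ge \omega(G)$; (ii) $S_0(G) \ge \theta(G) \ge \alpha(G)$.
   Context: Graphs are finite and simple with nonempty vertex set; $n = |V(G)|$. A set $A \subseteq V(G)$ is small if $\deg(v) \le n - |A|$ for every $v \in A$, and a set $B \subseteq V(G)$ is large if $\deg(v) \ge |B| - 1$ for every $v \in B$. $S_0(G)$ is the maximum cardinality of a small set and $L_0(G)$ the maximum cardinality of a large set of $G$. $\chi(G)$, $\omega(G)$, $\alpha(G)$ are the chromatic, clique and independence numbers; $\theta(G)$ is the clique-partition number, i.e. the minimum number of cliques into which $V(G)$ can be partitioned (so $\theta(G)=\chi(\overline{G})$, where $\overline{G}$ is the complement of $G$). *)

theory Defs
  imports "Graph_Theory.Pair_Digraph" "HOL-Library.Disjoint_Sets"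
begin

text \<open>
  A finite simple graph is a symmetric loop-free finite digraph whose arcs are ordered pairs
  (locale \<^locale>\<open>pair_graph\<close>): an edge \<open>uv\<close> is the pair of arcs \<open>(u, v)\<close> and \<open>(v, u)\<close>,
  so that the degree of a vertex is its out-degree.
\<close>

definition deg :: "'a pair_pre_digraph \<Rightarrow> 'a \<Rightarrow> nat" where
  "deg G v = out_degree (with_proj G) v"

definition small_set :: "'a pair_pre_digraph \<Rightarrow> 'a set \<Rightarrow> bool" where
  "small_set G A \<longleftrightarrow> A \<subseteq> pverts G \<and>
     (\<forall>v\<in>A. int (deg G v) \<le> int (card (pverts G)) - int (card A))"

definition large_set :: "'a pair_pre_digraph \<Rightarrow> 'a set \<Rightarrow> bool" where
  "large_set G B \<longleftrightarrow> B \<subseteq> pverts G \<and>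
     (\<forall>v\<in>B. int (deg G v) \<ge> int (card B) - 1)"

definition S0 :: "'a pair_pre_digraph \<Rightarrow> nat" where
  "S0 G = Max {card A | A. small_set G A}"

definition L0 :: "'a pair_pre_digraph \<Rightarrow> nat" where
  "L0 G = Max {card B | B. large_set G B}"

definition clique :: "'a pair_pre_digraph \<Rightarrow> 'a set \<Rightarrow> bool" where
  "clique G K \<longleftrightarrow> K \<subseteq> pverts G \<and> (\<forall>u\<in>K. \<forall>v\<in>K. u \<noteq> v \<longrightarrow> (u, v) \<in> parcs G)"

definition independent_set :: "'a pair_pre_digraph \<Rightarrow> 'a set \<Rightarrow> bool" where
  "independent_set G I \<longleftrightarrow> I \<subseteq> pverts G \<and> (\<forall>u\<in>I. \<forall>v\<in>I. (u, v) \<notin> parcs G)"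

definition clique_number :: "'a pair_pre_digraph \<Rightarrow> nat" where
  "clique_number G = Max {card K | K. clique G K}"

definition independence_number :: "'a pair_pre_digraph \<Rightarrow> nat" where
  "independence_number G = Max {card I | I. independent_set G I}"

definition proper_colouring :: "'a pair_pre_digraph \<Rightarrow> nat \<Rightarrow> ('a \<Rightarrow> nat) \<Rightarrow> bool" where
  "proper_colouring G k c \<longleftrightarrow>
     (\<forall>v\<in>pverts G. c v < k) \<and> (\<forall>(u, v)\<in>parcs G. c u \<noteq> c v)"

definition chromatic_number :: "'a pair_pre_digraph \<Rightarrow> nat" where
  "chromatic_number G = (LEAST k. \<exists>c. proper_colouring G k c)"

definition clique_partition :: "'a pair_pre_digraph \<Rightarrow> 'a set set \<Rightarrow> bool" where
  "clique_partition G P \<longleftrightarrow> partition_on (pverts G) P \<and> (\<forall>K\<in>P. clique G K)"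

definition clique_partition_number :: "'a pair_pre_digraph \<Rightarrow> nat" where
  "clique_partition_number G = (LEAST k. \<exists>P. clique_partition G P \<and> card P = k)"

end

theory Submission
  imports Defs
begin

text \<open>
  The vertices of degree at least \<open>m = L\<^sub>0\<close> number at most \<open>m\<close>, for otherwise \<open>m + 1\<close> of them
  would form a large set. Give them distinct colours out of \<open>m\<close> and colour the remaining vertices,
  whose degrees are below \<open>m\<close>, greedily. Part (ii) is the same argument for the complement,
  where a small set becomes a large one and a colour class becomes a clique.
\<close>

text \<open>The vertices of \<open>D\<close> are coloured one after another. Each has fewer than
  \<open>m\<close> neighbours in all of \<open>V\<close>, so whatever colours these carry, one of
  the \<open>m\<close> colours is free.\<close>

lemma greedy_colouring_extension:
  fixes E :: "'a \<Rightarrow> 'a \<Rightarrow> bool" and c :: "'a \<Rightarrow> nat"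
  assumes "finite D" "finite V" "H \<subseteq> V" "D \<subseteq> V"
    and sym: "\<And>u v. u \<in> V \<Longrightarrow> v \<in> V \<Longrightarrow> E u v \<Longrightarrow> E v u"
    and irrefl: "\<And>v. v \<in> V \<Longrightarrow> \<not> E v v"
    and low: "\<And>v. v \<in> D \<Longrightarrow> card {w \<in> V. E v w} < m"
    and c: "\<forall>v\<in>H. c v < m" "\<forall>u\<in>H. \<forall>v\<in>H. E u v \<longrightarrow> c u \<noteq> c v"
  shows "\<exists>d. (\<forall>v\<in>H \<union> D. d v < m) \<and> (\<forall>u\<in>H \<union> D. \<forall>v\<in>H \<union> D. E u v \<longrightarrow> d u \<noteq> d v)"
  using \<open>finite D\<close> \<open>D \<subseteq> V\<close> low
proof (induction D rule: finite_induct)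
  case empty
  show ?case using c by auto
next
  case (insert x D)
  then have "\<exists>d. (\<forall>v\<in>H \<union> D. d v < m) \<and> (\<forall>u\<in>H \<union> D. \<forall>v\<in>H \<union> D. E u v \<longrightarrow> d u \<noteq> d v)"
    by simp
  then obtain d where d: "\<forall>v\<in>H \<union> D. d v < m"
      "\<forall>u\<in>H \<union> D. \<forall>v\<in>H \<union> D. E u v \<longrightarrow> d u \<noteq> d v"
    by blast
  define W where "W = H \<union> D"
  have WV: "W \<subseteq> V" "x \<in> V" using insert.prems \<open>H \<subseteq> V\<close> by (auto simp: W_def)
  \<comment> \<open>Neighbours outside \<open>H \<union> D\<close> are counted too, although
    \<open>d\<close> is arbitrary there. This only forbids additional values, and the degree bound
    covers them all.\<close>
  have "card (d ` {w \<in> V. E x w}) \<le> card {w \<in> V. E x w}"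
    using \<open>finite V\<close> by (simp add: card_image_le)
  also have "\<dots> < card {..<m}" using insert.prems by simp
  finally have "\<not> {..<m} \<subseteq> d ` {w \<in> V. E x w}"
    using \<open>finite V\<close> card_mono[of "d ` {w \<in> V. E x w}" "{..<m}"] by auto
  then obtain i where i: "i < m" "i \<notin> d ` {w \<in> V. E x w}" by auto
  have "(d(x := i)) u \<noteq> (d(x := i)) v"
    if "u \<in> insert x W" "v \<in> insert x W" "E u v" for u v
  proof -
    have "u \<in> V" "v \<in> V" using that WV by auto
    moreover have "d u \<noteq> d v" if "u \<noteq> x" "v \<noteq> x"
      using that \<open>u \<in> insert x W\<close> \<open>v \<in> insert x W\<close> \<open>E u v\<close> d(2) by (auto simp: W_def)
    \<comment> \<open>If an end of the edge is \<open>x\<close>, then \<open>irrefl\<close> makes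
      the other end different from \<open>x\<close>, and \<open>sym\<close> makes it a neighbour of
      \<open>x\<close>, so its colour is not \<open>i\<close>.\<close>
    ultimately show ?thesis
      using i(2) sym irrefl \<open>E u v\<close> by auto
  qed
  moreover have "\<forall>v\<in>insert x W. (d(x := i)) v < m"
    using d(1) i(1) by (auto simp: W_def)
  ultimately show ?case unfolding W_def by (intro exI[of _ "d(x := i)"]) auto
qed

text \<open>Stated for a bare relation so that it serves both adjacency and non-adjacency. The
  hypothesis \<open>bound\<close> says that \<open>m\<close> bounds the size of every large set of
  \<open>E\<close>, with the subtraction of 1 moved across to stay in the naturals.\<close>

lemma colouring_by_large_set_bound:
  fixes E :: "'a \<Rightarrow> 'a \<Rightarrow> bool"
  assumes "finite V"
    and sym: "\<And>u v. u \<in> V \<Longrightarrow> v \<in> V \<Longrightarrow> E u v \<Longrightarrow> E v u"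
    and irrefl: "\<And>v. v \<in> V \<Longrightarrow> \<not> E v v"
    and bound: "\<And>B. B \<subseteq> V \<Longrightarrow> (\<And>v. v \<in> B \<Longrightarrow> card B \<le> card {w \<in> V. E v w} + 1) \<Longrightarrow> card B \<le> m"
  shows "\<exists>c :: 'a \<Rightarrow> nat. (\<forall>v\<in>V. c v < m) \<and> (\<forall>u\<in>V. \<forall>v\<in>V. E u v \<longrightarrow> c u \<noteq> c v)"
proof -
  define H where "H = {v \<in> V. m \<le> card {w \<in> V. E v w}}"
  have H: "H \<subseteq> V" "finite H" using \<open>finite V\<close> by (auto simp: H_def)
  have "card H \<le> m"
  proof (rule ccontr)
    assume "\<not> card H \<le> m"
    \<comment> \<open>Each vertex of \<open>B\<close> has degree at least
      \<open>m = card B - 1\<close>, so \<open>B\<close> is large and yet exceeds the bound by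
      one.\<close>
    then obtain B where "B \<subseteq> H" "card B = Suc m"
      by (metis not_less_eq_eq obtain_subset_with_card_n)
    then show False using bound[of B] by (auto simp: H_def)
  qed
  \<comment> \<open>Distinct colours on \<open>H\<close> are proper whatever edges \<open>H\<close>
    contains.\<close>
  obtain c :: "'a \<Rightarrow> nat" where inj: "inj_on c H" and img: "c ` H = {0..<card H}"
    using ex_bij_betw_finite_nat[OF \<open>finite H\<close>] by (auto simp: bij_betw_def)
  have c: "\<forall>v\<in>H. c v < m"
  proof
    fix v assume "v \<in> H"
    then have "c v \<in> {0..<card H}" using img by blast
    then show "c v < m" using \<open>card H \<le> m\<close> by simp
  qed
  have proper: "\<forall>u\<in>H. \<forall>v\<in>H. E u v \<longrightarrow> c u \<noteq> c v"
    using irrefl H inj unfolding inj_on_def by blast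
  have low: "card {w \<in> V. E v w} < m" if "v \<in> V - H" for v
    using that by (auto simp: H_def)
  have "H \<union> (V - H) = V" using H by auto
  then show ?thesis
    using greedy_colouring_extension[of "V - H" V H E m c, OF _ \<open>finite V\<close> H(1) Diff_subset sym
        irrefl low c proper] \<open>finite V\<close> by simp
qed

lemma deg_eq_card_neighbours:
  assumes "pair_graph G"
  shows "deg G v = card {w \<in> pverts G. (v, w) \<in> parcs G}"
proof -
  interpret pair_graph G by fact
  have "out_arcs (with_proj G) v = Pair v ` {w \<in> pverts G. (v, w) \<in> parcs G}"
    using in_arcsD2 by (fastforce simp: out_arcs_def)
  then show ?thesis by (simp add: deg_def out_degree_def card_image inj_on_def)
qed

text \<open>Supplies the finiteness that makes \<open>Max\<close> meaningful in \<open>L0\<close>,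
  \<open>S0\<close>, \<open>clique_number\<close> and \<open>independence_number\<close>.\<close>

lemma finite_card_Collect:
  assumes "finite V" "\<And>A. P A \<Longrightarrow> A \<subseteq> V"
  shows "finite {card A | A. P A}"
  by (rule finite_subset[of _ "card ` Pow V"]) (use assms in auto)

lemma colouring_with_L0_colours:
  assumes "pair_graph G"
  shows "\<exists>c. proper_colouring G (L0 G) c"
proof -
  interpret pair_graph G by fact
  have le: "card B \<le> L0 G" if "large_set G B" for B
    unfolding L0_def using that
    by (intro Max_ge finite_card_Collect[of "pverts G"]) (auto simp: large_set_def)
  have "\<exists>c :: 'a \<Rightarrow> nat. (\<forall>v\<in>pverts G. c v < L0 G) \<and>
      (\<forall>u\<in>pverts G. \<forall>v\<in>pverts G. (u, v) \<in> parcs G \<longrightarrow> c u \<noteq> c v)"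
  proof (rule colouring_by_large_set_bound[OF pair_finite_verts])
    fix B
    assume B: "B \<subseteq> pverts G"
      and "\<And>v. v \<in> B \<Longrightarrow> card B \<le> card {w \<in> pverts G. (v, w) \<in> parcs G} + 1"
    then have "\<And>v. v \<in> B \<Longrightarrow> card B \<le> deg G v + 1"
      by (simp add: deg_eq_card_neighbours[OF assms])
    with B have "large_set G B" by (fastforce simp: large_set_def)
    then show "card B \<le> L0 G" by (rule le)
  qed (use arcs_symmetric no_loops' in blast)+
  then show ?thesis
    unfolding proper_colouring_def using in_arcsD1 in_arcsD2 by blast
qed

text \<open>Distinct members of a clique are adjacent, so a proper colouring is injective on
  it.\<close>

lemma card_clique_le_colours:
  assumes "clique G K" "proper_colouring G k c"
  shows "card K \<le> k"
proof -
  have "inj_on c K" "c ` K \<subseteq> {..<k}"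
    using assms by (fastforce simp: clique_def proper_colouring_def inj_on_def)+
  then show ?thesis by (metis card_inj_on_le card_lessThan finite_lessThan)
qed

lemma clique_partition_with_S0_cliques:
  assumes "pair_graph G"
  obtains P where "clique_partition G P" "card P \<le> S0 G"
proof -
  interpret pair_graph G by fact
  let ?V = "pverts G"
  \<comment> \<open>Adjacency in the complement graph; \<open>u \<noteq> v\<close> keeps it
    irreflexive.\<close>
  define E where "E u v \<longleftrightarrow> u \<noteq> v \<and> (u, v) \<notin> parcs G" for u v
  have le: "card A \<le> S0 G" if "small_set G A" for A
    unfolding S0_def using that
    by (intro Max_ge finite_card_Collect[of ?V]) (auto simp: small_set_def)
  \<comment> \<open>The degrees of \<open>v\<close> in the graph and in its complement add up to n -
    1. Hence deg(v) \<le> n - |A| says that |A| - 1 is at most the complement degree: small sets are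
    the large sets of the complement.\<close>
  have compl: "deg G v + card {w \<in> ?V. E v w} + 1 = card ?V" if "v \<in> ?V" for v
  proof -
    let ?N = "{w \<in> ?V. (v, w) \<in> parcs G}" and ?M = "{w \<in> ?V. E v w}"
    have "v \<notin> ?N" using no_loops' by auto
    then have "?V = insert v (?N \<union> ?M)" "v \<notin> ?N \<union> ?M" "?N \<inter> ?M = {}"
      using that by (auto simp: E_def)
    then have "card ?V = Suc (card ?N + card ?M)"
      using card_insert_disjoint[of "?N \<union> ?M" v] card_Un_disjoint[of ?N ?M] by simp
    then show ?thesis by (simp add: deg_eq_card_neighbours[OF assms])
  qed
  have "\<exists>c :: 'a \<Rightarrow> nat. (\<forall>v\<in>?V. c v < S0 G) \<and> (\<forall>u\<in>?V. \<forall>v\<in>?V. E u v \<longrightarrow> c u \<noteq> c v)"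
  proof (rule colouring_by_large_set_bound[OF pair_finite_verts])
    fix A
    assume A: "A \<subseteq> ?V" "\<And>v. v \<in> A \<Longrightarrow> card A \<le> card {w \<in> ?V. E v w} + 1"
    have "int (deg G v) \<le> int (card ?V) - int (card A)" if "v \<in> A" for v
      using that A(1) A(2)[of v] compl[of v] by auto
    with A(1) have "small_set G A" by (simp add: small_set_def)
    then show "card A \<le> S0 G" by (rule le)
  qed (use arcs_symmetric in \<open>auto simp: E_def\<close>)
  then obtain c :: "'a \<Rightarrow> nat" where c: "\<forall>v\<in>?V. c v < S0 G"
      "\<forall>u\<in>?V. \<forall>v\<in>?V. E u v \<longrightarrow> c u \<noteq> c v"
    by blast
  \<comment> \<open>Only colours that occur are used as indices, since a partition may not contain
    the empty set.\<close>
  define P where "P = (\<lambda>i. {v \<in> ?V. c v = i}) ` (c ` ?V)"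
  have "partition_on ?V P"
    unfolding P_def by (rule partition_onI) (auto simp: disjnt_def)
  \<comment> \<open>Distinct vertices of equal colour are not joined in the complement, hence are
    adjacent in \<open>G\<close>.\<close>
  moreover have "clique G {v \<in> ?V. c v = i}" for i
    unfolding clique_def
  proof (intro conjI ballI impI)
    fix u v assume "u \<in> {v \<in> ?V. c v = i}" "v \<in> {v \<in> ?V. c v = i}" "u \<noteq> v"
    then show "(u, v) \<in> parcs G" using c(2)[rule_format, of u v] by (auto simp: E_def)
  qed auto
  ultimately have "clique_partition G P"
    by (auto simp: clique_partition_def P_def)
  moreover have "card P \<le> S0 G"
  proof -
    have "card P \<le> card (c ` ?V)" unfolding P_def by (simp add: card_image_le)
    also have "\<dots> \<le> card {..<S0 G}" using c(1) by (intro card_mono) auto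
    finally show ?thesis by simp
  qed
  ultimately show thesis by (rule that)
qed

text \<open>A clique contains at most one vertex of an independent set, so sending each vertex of
  \<open>I\<close> to a part containing it is injective.\<close>

lemma card_independent_set_le_cliques:
  assumes "independent_set G I" "clique_partition G P" "finite (pverts G)"
  shows "card I \<le> card P"
proof -
  have I: "I \<subseteq> \<Union>P" "finite P"
    using assms finite_elements[of "pverts G" P]
    by (auto simp: independent_set_def clique_partition_def partition_on_def)
  then have "\<forall>v\<in>I. \<exists>K. K \<in> P \<and> v \<in> K" by blast
  then obtain f where f: "\<And>v. v \<in> I \<Longrightarrow> f v \<in> P \<and> v \<in> f v"
    using bchoice[of I "\<lambda>v K. K \<in> P \<and> v \<in> K"] by blast
  have "inj_on f I"
  proof (rule inj_onI, rule ccontr)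
    fix u v assume "u \<in> I" "v \<in> I" "f u = f v" "u \<noteq> v"
    moreover have "clique G (f u)"
      using f[OF \<open>u \<in> I\<close>] assms(2) by (auto simp: clique_partition_def)
    ultimately show False
      using f[of u] f[of v] assms(1) unfolding clique_def independent_set_def by metis
  qed
  then show ?thesis using f I(2) by (intro card_inj_on_le[of f]) auto
qed

theorem mainTheorem3:
  fixes G :: "'a pair_pre_digraph"
  assumes "pair_graph G"
    and "pverts G \<noteq> {}"
  shows "(L0 G \<ge> chromatic_number G \<and> chromatic_number G \<ge> clique_number G) \<and>
         (S0 G \<ge> clique_partition_number G \<and> clique_partition_number G \<ge> independence_number G)"
proof -
  interpret pair_graph G by fact
  have "\<exists>c. proper_colouring G (L0 G) c"
    using assms(1) by (rule colouring_with_L0_colours)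
  \<comment> \<open>One witness with \<open>L0 G\<close> colours gives both the upper bound on the
    least number and the fact that this number is attained.\<close>
  then have chi_le: "chromatic_number G \<le> L0 G"
    and "\<exists>c. proper_colouring G (chromatic_number G) c"
    unfolding chromatic_number_def by (rule Least_le, rule LeastI)
  then obtain c where c: "proper_colouring G (chromatic_number G) c" by blast
  \<comment> \<open>Bounding a \<open>Max\<close> from above needs a nonempty set of cardinalities;
    the empty clique provides a member.\<close>
  have "clique G {}" by (simp add: clique_def)
  then have omega_le: "clique_number G \<le> chromatic_number G"
    unfolding clique_number_def using card_clique_le_colours[OF _ c]
    by (intro Max.boundedI finite_card_Collect[of "pverts G"]) (auto simp: clique_def)
  obtain P where P: "clique_partition G P" "card P \<le> S0 G"
    using clique_partition_with_S0_cliques[OF assms(1)] by blast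
  then have ex: "\<exists>Q. clique_partition G Q \<and> card Q = card P" by blast
  have theta_le: "clique_partition_number G \<le> S0 G"
    using Least_le[of "\<lambda>k. \<exists>Q. clique_partition G Q \<and> card Q = k", OF ex] P(2)
    by (simp add: clique_partition_number_def)
  obtain Q where Q: "clique_partition G Q" "card Q = clique_partition_number G"
    using LeastI[of "\<lambda>k. \<exists>Q. clique_partition G Q \<and> card Q = k", OF ex]
    by (auto simp: clique_partition_number_def)
  have "independent_set G {}" by (simp add: independent_set_def)
  then have alpha_le: "independence_number G \<le> clique_partition_number G"
    unfolding independence_number_def Q(2)[symmetric]
    using card_independent_set_le_cliques[OF _ Q(1)]
    by (intro Max.boundedI finite_card_Collect[of "pverts G"]) (auto simp: independent_set_def)
  show ?thesis using chi_le omega_le theta_le alpha_le by blast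
qed

end
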